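(* Let $V_M^{\mathrm{RF}}=\mathrm{span}\{\varphi_1,\dots,\varphi_M\}$, $\boldsymbol\varphi=(\varphi_1,\dots,\varphi_M)^{T}$, and let $V_K^{\mathrm{CARE}}\subset V_M^{\mathrm{RF}}$, $\varepsilon_{M,N,K}^{\mathrm{QR}}$, $\Lambda_M(X)$ and $\mathfrak a_{M,N,K}^X$ be as defined in the context. For every $v_M=\boldsymbol\varphi^{T}\boldsymbol a\in V_M^{\mathrm{RF}}$ with $\boldsymbol a\in\mathbb R^M$, $$\inf_{v_K\in V_K^{\mathrm{CARE}}}\|v_M-v_K\|_{Q,N}\le\varepsilon_{M,N,K}^{\mathrm{QR}}\|\boldsymbol a\|_2 .$$ Therefore, for every normed space $X$ of functions containing $V_M^{\mathrm{RF}}$ and every $f\in X$, $$\inf_{v_K\in V_K^{\mathrm{CARE}}}\|f-v_K\|_X\le\mathfrak a_{M,N,K}^X(f).$$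
   Context: $\varphi_1,\dots,\varphi_M$ are candidate feature functions on $\Omega\subset\mathbb R^d$ (Gaussian radial functions $\exp(-\|\boldsymbol x-\boldsymbol c_j\|^2/(2\sigma_j^2))$, or their periodizations on a periodic rectangular cell). $\{\boldsymbol x_q,w_q\}_{q=1}^N$ are quadrature nodes and positive weights, $\|v\|_{Q,N}=\left(\sum_qw_qv(\boldsymbol x_q)^2\right)^{1/2}$, $W_N=\mathrm{diag}(w_q)$, $(\Phi_{M,N})_{qj}=\varphi_j(\boldsymbol x_q)$, $A_{M,N}=W_N^{1/2}\Phi_{M,N}$. A column-pivoted QR factorization $A_{M,N}\mathsf P=Q\mathsf R$ is computed ($\mathsf P$ a permutation matrix, $Q\in\mathbb R^{N\times M}$ with orthonormal columns, $\mathsf R$ upper triangular), and $K=\max\{k:|\mathsf R_{kk}|/|\mathsf R_{11}|\ge\tau_{\mathrm{QR}}\}$ for a tolerance $\tau_{\mathrm{QR}}>0$. Let $\mathsf P_K$, $Q_K$ be the first $K$ columns of $\mathsf P$, $Q$ and $\mathsf R_K$ the leading $K\times K$ block of $\mathsf R$ (nonsingular), so $A_{M,N}\mathsf P_K=Q_K\mathsf R_K$. The CARE basis is $(\psi_1,\dots,\psi_K)=\boldsymbol\varphi^{T}\mathsf P_K\mathsf R_K^{-1}$ and $V_K^{\mathrm{CARE}}=\mathrm{span}\{\psi_1,\dots,\psi_K\}$, i.e. the span of the $K$ retained features; the columns of $Q_K$ span the retained weighted sampled columns. Definitions: $\varepsilon_{M,N,K}^{\mathrm{QR}}=\|(I_N-Q_KQ_K^{T})A_{M,N}\|_2$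 (spectral norm). $\Lambda_M(X)=\sup_{0\ne v\in V_M^{\mathrm{RF}}}\|v\|_X/\|v\|_{Q,N}$, with $\Lambda_M(X)=\infty$ when nodal sampling $v\mapsto(v(\boldsymbol x_q))_q$ is not injective on $V_M^{\mathrm{RF}}$. Finally $$\mathfrak a_{M,N,K}^X(f)=\inf_{\boldsymbol a\in\mathbb R^M}\left[\|f-\boldsymbol\varphi^{T}\boldsymbol a\|_X+\Lambda_M(X)\,\varepsilon_{M,N,K}^{\mathrm{QR}}\,\|\boldsymbol a\|_2\right],$$ interpreted as $+\infty$ (so the second inequality is void) when $\Lambda_M(X)=\infty$. *)

theory Defs
  imports
    "HOL-Analysis.Analysis"
    "HOL-Combinatorics.Permutations"
    "Jordan_Normal_Form.Gauss_Jordan_Elimination"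
begin

text \<open>
  All indices are 0-based: features \<open>\<phi> j\<close> with \<open>j < M\<close>, nodes \<open>x q\<close> and weights \<open>w q\<close> with
  \<open>q < N\<close>. Matrices and coefficient vectors are those of \<open>Jordan_Normal_Form\<close>, since the number of
  retained columns depends on the factorization. A real function on \<open>\<Omega>\<close> is represented by its
  extension by 0, so that equality of functions on \<open>\<Omega>\<close> is equality in HOL.
\<close>

definition zero_ext :: "'d set \<Rightarrow> ('d \<Rightarrow> real) \<Rightarrow> 'd \<Rightarrow> real" where
  "zero_ext \<Omega> f = (\<lambda>x. if x \<in> \<Omega> then f x else 0)"


subsection \<open>Features\<close>

definition gaussian :: "'d::euclidean_space \<Rightarrow> real \<Rightarrow> 'd \<Rightarrow> real" where
  "gaussian c \<sigma> x = exp (- ((norm (x - c))\<^sup>2 / (2 * \<sigma>\<^sup>2)))"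

definition period_lattice :: "'d::euclidean_space \<Rightarrow> 'd set" where
  "period_lattice l = {k. \<forall>e\<in>Basis. \<exists>m::int. inner k e = of_int m * inner l e}"

definition periodized_gaussian ::
    "'d::euclidean_space \<Rightarrow> 'd \<Rightarrow> real \<Rightarrow> 'd \<Rightarrow> real" where
  "periodized_gaussian l c \<sigma> x = (\<Sum>\<^sub>\<infinity>k\<in>period_lattice l. gaussian c \<sigma> (x + k))"

definition gaussian_features ::
    "'d::euclidean_space set \<Rightarrow> nat \<Rightarrow> (nat \<Rightarrow> 'd \<Rightarrow> real) \<Rightarrow> bool" where
  "gaussian_features \<Omega> M \<phi> \<longleftrightarrow>
     (\<exists>c \<sigma>. \<forall>j<M. \<sigma> j > 0 \<and> \<phi> j = zero_ext \<Omega> (gaussian (c j) (\<sigma> j)))"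

text \<open>The cell may contain any part of its boundary (open, closed or half-open fundamental cell).\<close>

definition periodic_gaussian_features ::
    "'d::euclidean_space set \<Rightarrow> nat \<Rightarrow> (nat \<Rightarrow> 'd \<Rightarrow> real) \<Rightarrow> bool" where
  "periodic_gaussian_features \<Omega> M \<phi> \<longleftrightarrow>
     (\<exists>a b. (\<forall>e\<in>Basis. inner a e < inner b e) \<and> box a b \<subseteq> \<Omega> \<and> \<Omega> \<subseteq> cbox a b \<and>
        (\<exists>c \<sigma>. \<forall>j<M. \<sigma> j > 0 \<and>
           \<phi> j = zero_ext \<Omega> (periodized_gaussian (b - a) (c j) (\<sigma> j))))"

definition lin_comb :: "nat \<Rightarrow> (nat \<Rightarrow> 'd \<Rightarrow> real) \<Rightarrow> real vec \<Rightarrow> 'd \<Rightarrow> real" where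
  "lin_comb n g a = (\<lambda>x. \<Sum>j<n. g j x * vec_index a j)"

definition fun_span :: "nat \<Rightarrow> (nat \<Rightarrow> 'd \<Rightarrow> real) \<Rightarrow> ('d \<Rightarrow> real) set" where
  "fun_span n g = lin_comb n g ` carrier_vec n"


subsection \<open>Norms and sampled feature matrix\<close>

definition norm2 :: "real vec \<Rightarrow> real" where
  "norm2 v = sqrt (\<Sum>i<dim_vec v. (vec_index v i)\<^sup>2)"

definition spectral_norm :: "real mat \<Rightarrow> real" where
  "spectral_norm A = (SUP v\<in>{v \<in> carrier_vec (dim_col A). norm2 v \<le> 1}. norm2 (A *\<^sub>v v))"

definition quad_norm :: "nat \<Rightarrow> (nat \<Rightarrow> 'd) \<Rightarrow> (nat \<Rightarrow> real) \<Rightarrow> ('d \<Rightarrow> real) \<Rightarrow> real" where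
  "quad_norm N x w v = sqrt (\<Sum>q<N. w q * (v (x q))\<^sup>2)"

definition weighted_feature_mat ::
    "nat \<Rightarrow> nat \<Rightarrow> (nat \<Rightarrow> 'd \<Rightarrow> real) \<Rightarrow> (nat \<Rightarrow> 'd) \<Rightarrow> (nat \<Rightarrow> real) \<Rightarrow> real mat" where
  "weighted_feature_mat M N \<phi> x w =
     mat_diag N (\<lambda>q. sqrt (w q)) * mat N M (\<lambda>(q, j). \<phi> j (x q))"


subsection \<open>Column-pivoted QR factorization and the CARE space\<close>

definition permutation_mat :: "nat \<Rightarrow> real mat \<Rightarrow> bool" where
  "permutation_mat n P \<longleftrightarrow>
     (\<exists>\<pi>. \<pi> permutes {..<n} \<and> P = mat n n (\<lambda>(i, j). if i = \<pi> j then 1 else 0))"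

text \<open>
  The last condition is the column pivoting rule: after \<open>k\<close> elimination steps the remaining part of
  column \<open>j\<close> has squared norm \<open>\<Sum>i=k..j. (R $$ (i,j))\<^sup>2\<close>, and the pivot column, whose
  remaining norm is \<open>\<bar>R $$ (k,k)\<bar>\<close>, is one for which this is largest.
\<close>

definition column_pivoted_qr :: "real mat \<Rightarrow> real mat \<Rightarrow> real mat \<Rightarrow> real mat \<Rightarrow> bool" where
  "column_pivoted_qr A P Q R \<longleftrightarrow>
     permutation_mat (dim_col A) P \<and>
     Q \<in> carrier_mat (dim_row A) (dim_col A) \<and>
     transpose_mat Q * Q = 1\<^sub>m (dim_col A) \<and>
     R \<in> carrier_mat (dim_col A) (dim_col A) \<and>
     upper_triangular R \<and>
     A * P = Q * R \<and>
     (\<forall>k j. k \<le> j \<and> j < dim_col A \<longrightarrow> (\<Sum>i=k..j. (R $$ (i, j))\<^sup>2) \<le> (R $$ (k, k))\<^sup>2)"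

text \<open>Here \<open>k\<close> is a number of columns, so the \<open>k\<close>-th diagonal entry is \<open>R $$ (k - 1, k - 1)\<close>.\<close>

definition qr_admissible :: "real \<Rightarrow> real mat \<Rightarrow> nat set" where
  "qr_admissible \<tau> R =
     {k \<in> {1..dim_row R}. \<bar>R $$ (k - 1, k - 1)\<bar> / \<bar>R $$ (0, 0)\<bar> \<ge> \<tau>}"

definition first_cols :: "nat \<Rightarrow> real mat \<Rightarrow> real mat" where
  "first_cols k A = mat (dim_row A) k (\<lambda>(i, j). A $$ (i, j))"

definition leading_block :: "nat \<Rightarrow> real mat \<Rightarrow> real mat" where
  "leading_block k A = mat k k (\<lambda>(i, j). A $$ (i, j))"

definition care_basis ::
    "nat \<Rightarrow> (nat \<Rightarrow> 'd \<Rightarrow> real) \<Rightarrow> real mat \<Rightarrow> real mat \<Rightarrow> nat \<Rightarrow> nat \<Rightarrow> 'd \<Rightarrow> real" where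
  "care_basis M \<phi> P R K k =
     lin_comb M \<phi> (col (first_cols K P * the (mat_inverse (leading_block K R))) k)"

definition care_space ::
    "nat \<Rightarrow> (nat \<Rightarrow> 'd \<Rightarrow> real) \<Rightarrow> real mat \<Rightarrow> real mat \<Rightarrow> nat \<Rightarrow> ('d \<Rightarrow> real) set" where
  "care_space M \<phi> P R K = fun_span K (care_basis M \<phi> P R K)"

definition qr_error :: "real mat \<Rightarrow> real mat \<Rightarrow> nat \<Rightarrow> real" where
  "qr_error A Q K =
     spectral_norm ((1\<^sub>m (dim_row A) - first_cols K Q * transpose_mat (first_cols K Q)) * A)"


subsection \<open>Normed function spaces and the best-approximation quantity\<close>

text \<open>
  \<open>X\<close> consists of functions on \<open>\<Omega>\<close>, where \<open>u\<close> and \<open>v\<close> are identified in the normed space iff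
  \<open>nX (u - v) = 0\<close>. This covers spaces of genuine functions (then \<open>nX\<close> is definite) as well as
  spaces such as \<open>L\<^sup>2\<close> or Sobolev spaces, whose elements are functions up to a.e. equality.
\<close>

definition normed_function_space ::
    "'d set \<Rightarrow> ('d \<Rightarrow> real) set \<Rightarrow> (('d \<Rightarrow> real) \<Rightarrow> real) \<Rightarrow> bool" where
  "normed_function_space \<Omega> X nX \<longleftrightarrow>
     (\<forall>u\<in>X. \<forall>x. x \<notin> \<Omega> \<longrightarrow> u x = 0) \<and>
     (\<lambda>x. 0) \<in> X \<and>
     (\<forall>u\<in>X. \<forall>v\<in>X. (\<lambda>x. u x + v x) \<in> X) \<and>
     (\<forall>r. \<forall>u\<in>X. (\<lambda>x. r * u x) \<in> X) \<and>
     (\<forall>u\<in>X. nX u \<ge> 0) \<and>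
     (\<forall>u\<in>X. \<forall>v\<in>X. nX (\<lambda>x. u x + v x) \<le> nX u + nX v) \<and>
     (\<forall>r. \<forall>u\<in>X. nX (\<lambda>x. r * u x) = \<bar>r\<bar> * nX u)"

text \<open>
  \<open>V\<close> is contained in the normed space, so no nonzero element of \<open>V\<close> is identified with 0.
\<close>

definition contained_in_normed ::
    "('d \<Rightarrow> real) set \<Rightarrow> ('d \<Rightarrow> real) set \<Rightarrow> (('d \<Rightarrow> real) \<Rightarrow> real) \<Rightarrow> bool" where
  "contained_in_normed V X nX \<longleftrightarrow> V \<subseteq> X \<and> (\<forall>v\<in>V. nX v = 0 \<longrightarrow> v = (\<lambda>x. 0))"

definition stability_const ::
    "(('d \<Rightarrow> real) \<Rightarrow> real) \<Rightarrow> nat \<Rightarrow> (nat \<Rightarrow> 'd) \<Rightarrow> (nat \<Rightarrow> real) \<Rightarrow> ('d \<Rightarrow> real) set \<Rightarrow> ennreal" where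
  "stability_const nX N x w V =
     (if inj_on (\<lambda>v. vec N (\<lambda>q. v (x q))) V
      then SUP v\<in>V - {\<lambda>x. 0}. ennreal (nX v / quad_norm N x w v)
      else \<infinity>)"

text \<open>
  The case distinction is needed because \<open>\<infinity> * 0 = 0\<close> in \<^typ>\<open>ennreal\<close>.
\<close>

definition care_bound ::
    "(('d \<Rightarrow> real) \<Rightarrow> real) \<Rightarrow> ennreal \<Rightarrow> real \<Rightarrow> nat \<Rightarrow> (nat \<Rightarrow> 'd \<Rightarrow> real) \<Rightarrow> ('d \<Rightarrow> real) \<Rightarrow> ennreal" where
  "care_bound nX \<Lambda> \<epsilon> M \<phi> f =
     (if \<Lambda> = \<infinity> then \<infinity>
      else INF a\<in>carrier_vec M.
        ennreal (nX (\<lambda>x. f x - lin_comb M \<phi> a x)) + \<Lambda> * ennreal (\<epsilon> * norm2 a))"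

end

theory Submission
  imports Defs "Jordan_Normal_Form.Determinant"
begin

text \<open>
  The coefficient matrix \<open>B = P\<^sub>K R\<^sub>K\<^sup>-\<^sup>1\<close> of the CARE basis turns the factorization into
  \<open>A B = Q\<^sub>K\<close>: the CARE function with coefficients \<open>c\<close> has the weighted samples
  \<open>Q\<^sub>K c\<close> (\<open>truncated_qr_inverse\<close>). The inverse exists because the pivoting rule makes the diagonal of \<open>R\<close>
  non-increasing in absolute value, so that an admissible last entry keeps all earlier ones away from 0.

  For \<open>v\<^sub>M = \<phi>\<^sup>T a\<close> the choice \<open>c = Q\<^sub>K\<^sup>T A a\<close> leaves the sampled residual
  \<open>(I - Q\<^sub>K Q\<^sub>K\<^sup>T) A a\<close>, whose Euclidean norm is at most the spectral norm of
  \<open>(I - Q\<^sub>K Q\<^sub>K\<^sup>T) A\<close> times the norm of \<open>a\<close> (\<open>care_approximant_exists\<close>). This is the first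
  inequality.

  For the second one, \<open>f - v\<close> is split into \<open>f - \<phi>\<^sup>T a\<close> and \<open>\<phi>\<^sup>T a - v\<close> with the same
  approximant \<open>v\<close>. The second part lies in the feature span, where the stability constant converts
  the sampled norm into the norm of \<open>X\<close> (\<open>norm_le_stability_const_quad_norm\<close>). Since \<open>a\<close> is
  arbitrary, the infimum over \<open>a\<close> may be taken.
\<close>


section \<open>Euclidean and spectral norm\<close>

lemma norm2_eq_L2_set: "norm2 v = L2_set (vec_index v) {..<dim_vec v}"
  by (simp add: norm2_def L2_set_def)

lemma norm2_nonneg: "0 \<le> norm2 v"
  by (simp add: norm2_eq_L2_set)

lemma norm2_smult: "norm2 (r \<cdot>\<^sub>v v) = \<bar>r\<bar> * norm2 v"
  by (simp add: norm2_def power_mult_distrib sum_distrib_left[symmetric] real_sqrt_mult)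

lemma norm2_eq_0_iff:
  assumes "v \<in> carrier_vec n"
  shows "norm2 v = 0 \<longleftrightarrow> v = 0\<^sub>v n"
  using assms by (auto simp: norm2_eq_L2_set L2_set_eq_0_iff intro!: eq_vecI)

lemma abs_entry_le_norm2: "i < dim_vec v \<Longrightarrow> \<bar>vec_index v i\<bar> \<le> norm2 v"
  unfolding norm2_def by (rule real_le_rsqrt) (auto intro: member_le_sum)

text \<open>
  A supremum in \<^typ>\<open>real\<close> is meaningful only for bounded sets. On the unit ball every coordinate is
  at most 1 in absolute value, so the sum of all absolute matrix entries is a crude bound.
\<close>

lemma bdd_above_norm2_on_ball:
  "bdd_above ((\<lambda>v. norm2 (B *\<^sub>v v)) ` {v \<in> carrier_vec (dim_col B). norm2 v \<le> 1})"
proof (rule bdd_aboveI2)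
  fix v assume "v \<in> {v \<in> carrier_vec (dim_col B). norm2 v \<le> 1}"
  then have v: "v \<in> carrier_vec (dim_col B)" and n: "norm2 v \<le> 1" by auto
  have entry: "\<bar>vec_index v j\<bar> \<le> 1" if "j < dim_col B" for j
    using abs_entry_le_norm2[of j v] that n v by auto
  have "norm2 (B *\<^sub>v v) \<le> (\<Sum>i<dim_row B. \<bar>vec_index (B *\<^sub>v v) i\<bar>)"
    using L2_set_le_sum_abs[of "vec_index (B *\<^sub>v v)" "{..<dim_row B}"]
    by (simp only: norm2_eq_L2_set dim_mult_mat_vec)
  also have "\<dots> \<le> (\<Sum>i<dim_row B. \<Sum>j<dim_col B. \<bar>B $$ (i, j)\<bar>)"
  proof (rule sum_mono)
    fix i assume "i \<in> {..<dim_row B}"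
    then have "vec_index (B *\<^sub>v v) i = (\<Sum>j<dim_col B. B $$ (i, j) * vec_index v j)"
      using v by (auto simp: scalar_prod_def lessThan_atLeast0 intro!: sum.cong)
    also have "\<bar>\<dots>\<bar> \<le> (\<Sum>j<dim_col B. \<bar>B $$ (i, j)\<bar> * \<bar>vec_index v j\<bar>)"
      by (rule order_trans[OF sum_abs]) (simp add: abs_mult)
    also have "\<dots> \<le> (\<Sum>j<dim_col B. \<bar>B $$ (i, j)\<bar>)"
      by (intro sum_mono mult_left_le) (use entry in auto)
    finally show "\<bar>vec_index (B *\<^sub>v v) i\<bar> \<le> (\<Sum>j<dim_col B. \<bar>B $$ (i, j)\<bar>)" .
  qed
  finally show "norm2 (B *\<^sub>v v) \<le> (\<Sum>i<dim_row B. \<Sum>j<dim_col B. \<bar>B $$ (i, j)\<bar>)" .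
qed

lemma norm2_mult_mat_vec_le:
  assumes v: "v \<in> carrier_vec (dim_col B)"
  shows "norm2 (B *\<^sub>v v) \<le> spectral_norm B * norm2 v"
proof (cases "norm2 v = 0")
  case True
  then have "v = 0\<^sub>v (dim_col B)" using norm2_eq_0_iff[OF v] by simp
  then have "B *\<^sub>v v = 0\<^sub>v (dim_row B)" by auto
  then show ?thesis using True by (simp add: norm2_def)
next
  case False
  then have pos: "0 < norm2 v" using norm2_nonneg[of v] by simp
  define u where "u = (1 / norm2 v) \<cdot>\<^sub>v v"
  have u: "u \<in> carrier_vec (dim_col B)" "norm2 u \<le> 1"
    using v pos by (simp_all add: u_def norm2_smult)
  have "v = norm2 v \<cdot>\<^sub>v u" using pos by (auto simp: u_def smult_smult_assoc)
  then have "B *\<^sub>v v = norm2 v \<cdot>\<^sub>v (B *\<^sub>v u)"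
    using mult_mat_vec[of B "dim_row B" "dim_col B" u "norm2 v"] u by simp
  then have "norm2 (B *\<^sub>v v) = norm2 v * norm2 (B *\<^sub>v u)"
    using pos by (simp add: norm2_smult)
  moreover have "norm2 (B *\<^sub>v u) \<le> spectral_norm B"
    unfolding spectral_norm_def by (rule cSUP_upper[OF _ bdd_above_norm2_on_ball]) (use u in simp)
  ultimately show ?thesis
    using pos by (simp add: mult.commute mult_left_mono)
qed


section \<open>Truncated pivoted QR factorization\<close>

text \<open>
  The square of \<open>R $$ (k, k)\<close> is one summand of the squared remaining norm of column \<open>k\<close> at the
  earlier step \<open>j\<close>, and the pivot chosen at that step dominates all remaining norms. A nonzero
  diagonal entry therefore forces all earlier ones to be nonzero.
\<close>

lemma pivoted_diag_antimono:
  assumes "column_pivoted_qr A P Q R" "j \<le> k" "k < dim_col A"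
  shows "(R $$ (k, k))\<^sup>2 \<le> (R $$ (j, j))\<^sup>2"
proof -
  have "(R $$ (k, k))\<^sup>2 \<le> (\<Sum>i=j..k. (R $$ (i, k))\<^sup>2)"
    by (rule member_le_sum) (use assms in auto)
  also have "\<dots> \<le> (R $$ (j, j))\<^sup>2"
    using assms unfolding column_pivoted_qr_def by blast
  finally show ?thesis .
qed

lemma admissible_diag_nonzero:
  assumes "k \<in> qr_admissible \<tau> R" "\<tau> > 0"
  shows "1 \<le> k" "k \<le> dim_row R" "R $$ (k - 1, k - 1) \<noteq> 0"
  using assms by (auto simp: qr_admissible_def)

lemma upper_triangular_mat_inverse:
  fixes U :: "'a::field mat"
  assumes U: "U \<in> carrier_mat n n" and ut: "upper_triangular U"
    and diag: "\<And>i. i < n \<Longrightarrow> U $$ (i, i) \<noteq> 0"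
  obtains V where "mat_inverse U = Some V" "U * V = 1\<^sub>m n" "V \<in> carrier_mat n n"
proof -
  have "det U = (\<Prod>i = 0..<n. U $$ (i, i))"
    using det_upper_triangular[OF ut U] U by (simp add: prod_list_diag_prod)
  then have "det U \<noteq> 0" using diag by simp
  then have "U \<in> Units (ring_mat TYPE('a) n ())"
    by (rule det_non_zero_imp_unit[OF U])
  then obtain V where "mat_inverse U = Some V"
    using mat_inverse(1)[OF U, of "()"] by (cases "mat_inverse U") auto
  with mat_inverse(2)[OF U] that show thesis by blast
qed

lemma first_cols_carrier: "A \<in> carrier_mat n m \<Longrightarrow> first_cols k A \<in> carrier_mat n k"
  by (simp add: first_cols_def)

lemma first_cols_mult:
  assumes "A \<in> carrier_mat n m" "B \<in> carrier_mat m l" "k \<le> l"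
  shows "first_cols k (A * B) = A * first_cols k B"
  using assms by (intro eq_matI) (auto simp: first_cols_def scalar_prod_def)

lemma first_cols_mult_upper_triangular:
  fixes Q R :: "real mat"
  assumes Q: "Q \<in> carrier_mat n m" and R: "R \<in> carrier_mat m m" and ut: "upper_triangular R"
    and k: "k \<le> m"
  shows "first_cols k (Q * R) = first_cols k Q * leading_block k R"
proof (rule eq_matI)
  fix i j
  assume "i < dim_row (first_cols k Q * leading_block k R)"
    and "j < dim_col (first_cols k Q * leading_block k R)"
  then have i: "i < n" and j: "j < k" using Q by (auto simp: first_cols_def leading_block_def)
  have "first_cols k (Q * R) $$ (i, j) = (\<Sum>l\<in>{0..<m}. Q $$ (i, l) * R $$ (l, j))"
    using Q R i j k by (auto simp: first_cols_def scalar_prod_def)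
  \<comment> \<open>Rows of \<open>R\<close> from \<open>k\<close> on vanish in the first \<open>k\<close> columns.\<close>
  also have "\<dots> = (\<Sum>l\<in>{0..<k}. Q $$ (i, l) * R $$ (l, j))"
    by (rule sum.mono_neutral_right) (use k R j upper_triangularD[OF ut] in auto)
  also have "\<dots> = (first_cols k Q * leading_block k R) $$ (i, j)"
    using Q i j by (auto simp: first_cols_def leading_block_def scalar_prod_def)
  finally show "first_cols k (Q * R) $$ (i, j) = (first_cols k Q * leading_block k R) $$ (i, j)" .
qed (use Q R in \<open>auto simp: first_cols_def leading_block_def\<close>)

text \<open>
  \<open>P\<^sub>K R\<^sub>K\<^sup>-\<^sup>1\<close> is the coefficient matrix of the CARE basis; its sampled weighted
  columns are exactly the orthonormal columns \<open>Q\<^sub>K\<close>, because \<open>A P\<^sub>K = Q\<^sub>K R\<^sub>K\<close>.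
\<close>

lemma truncated_qr_inverse:
  assumes qr: "column_pivoted_qr A P Q R" and K: "K \<in> qr_admissible \<tau> R" and tol: "\<tau> > 0"
  defines "B \<equiv> first_cols K P * the (mat_inverse (leading_block K R))"
  shows "B \<in> carrier_mat (dim_col A) K" "A * B = first_cols K Q"
proof -
  have R: "R \<in> carrier_mat (dim_col A) (dim_col A)" and ut: "upper_triangular R"
    and Q: "Q \<in> carrier_mat (dim_row A) (dim_col A)" and AP: "A * P = Q * R"
    and P: "P \<in> carrier_mat (dim_col A) (dim_col A)"
    using qr by (auto simp: column_pivoted_qr_def permutation_mat_def)
  note Kp = admissible_diag_nonzero[OF K tol]
  have KM: "K \<le> dim_col A" using Kp(2) R by simp
  have RK: "leading_block K R \<in> carrier_mat K K" by (simp add: leading_block_def)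
  have utK: "upper_triangular (leading_block K R)"
    using KM R upper_triangularD[OF ut] by (intro upper_triangularI) (auto simp: leading_block_def)
  have "leading_block K R $$ (j, j) \<noteq> 0" if "j < K" for j
  proof -
    have "(R $$ (K - 1, K - 1))\<^sup>2 \<le> (R $$ (j, j))\<^sup>2"
      by (rule pivoted_diag_antimono[OF qr]) (use that KM in auto)
    then show ?thesis using Kp(3) that by (auto simp: leading_block_def)
  qed
  then obtain V where V: "mat_inverse (leading_block K R) = Some V"
      "leading_block K R * V = 1\<^sub>m K" "V \<in> carrier_mat K K"
    using upper_triangular_mat_inverse[OF RK utK] by blast
  have PK: "first_cols K P \<in> carrier_mat (dim_col A) K" by (rule first_cols_carrier[OF P])
  have QK: "first_cols K Q \<in> carrier_mat (dim_row A) K" by (rule first_cols_carrier[OF Q])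
  have A: "A \<in> carrier_mat (dim_row A) (dim_col A)" by simp
  have B: "B = first_cols K P * V" by (simp add: B_def V(1))
  show "B \<in> carrier_mat (dim_col A) K" unfolding B by (rule mult_carrier_mat[OF PK V(3)])
  have "A * B = (A * first_cols K P) * V"
    unfolding B by (rule assoc_mult_mat[OF A PK V(3), symmetric])
  also have "A * first_cols K P = first_cols K Q * leading_block K R"
    using first_cols_mult[OF A P KM] first_cols_mult_upper_triangular[OF Q R ut KM] AP by simp
  also have "first_cols K Q * leading_block K R * V = first_cols K Q"
    using assoc_mult_mat[OF QK RK V(3)] V(2) QK by simp
  finally show "A * B = first_cols K Q" .
qed


section \<open>Feature combinations and their samples\<close>

lemma lin_comb_diff:
  assumes "a \<in> carrier_vec n" "b \<in> carrier_vec n"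
  shows "(\<lambda>y. lin_comb n g a y - lin_comb n g b y) = lin_comb n g (a - b)"
  using assms by (auto simp: lin_comb_def fun_eq_iff right_diff_distrib sum_subtractf[symmetric])

lemma lin_comb_lin_comb_cols:
  assumes B: "B \<in> carrier_mat m k" and c: "c \<in> carrier_vec k"
  shows "lin_comb k (\<lambda>i. lin_comb m g (col B i)) c = lin_comb m g (B *\<^sub>v c)"
proof
  fix y
  have "lin_comb k (\<lambda>i. lin_comb m g (col B i)) c y
      = (\<Sum>i<k. \<Sum>j<m. g j y * (B $$ (j, i) * vec_index c i))"
    using B by (auto simp: lin_comb_def sum_distrib_right mult.assoc intro!: sum.cong)
  also have "\<dots> = (\<Sum>j<m. \<Sum>i<k. g j y * (B $$ (j, i) * vec_index c i))"
    by (rule sum.swap)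
  also have "\<dots> = lin_comb m g (B *\<^sub>v c) y"
    using B c by (auto simp: lin_comb_def scalar_prod_def sum_distrib_left lessThan_atLeast0
        intro!: sum.cong)
  finally show "lin_comb k (\<lambda>i. lin_comb m g (col B i)) c y = lin_comb m g (B *\<^sub>v c) y" .
qed

lemma care_space_eq:
  fixes P R :: "real mat" and M K :: nat
  defines "B \<equiv> first_cols K P * the (mat_inverse (leading_block K R))"
  assumes B: "B \<in> carrier_mat M K"
  shows "care_space M \<phi> P R K = (\<lambda>c. lin_comb M \<phi> (B *\<^sub>v c)) ` carrier_vec K"
  unfolding care_space_def fun_span_def
proof (rule image_cong[OF refl])
  fix c :: "real vec" assume "c \<in> carrier_vec K"
  then show "lin_comb K (care_basis M \<phi> P R K) c = lin_comb M \<phi> (B *\<^sub>v c)"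
    using lin_comb_lin_comb_cols[OF B] by (simp add: care_basis_def[abs_def] B_def)
qed

lemma care_space_subset:
  assumes "column_pivoted_qr A P Q R" "K \<in> qr_admissible \<tau> R" "\<tau> > 0" "dim_col A = M"
  shows "care_space M \<phi> P R K \<subseteq> fun_span M \<phi>"
proof -
  have B: "first_cols K P * the (mat_inverse (leading_block K R)) \<in> carrier_mat M K"
    using truncated_qr_inverse(1)[OF assms(1-3)] assms(4) by simp
  show ?thesis
    unfolding care_space_eq[OF B] fun_span_def using mult_mat_vec_carrier[OF B] by blast
qed

lemma weighted_feature_mat_carrier: "weighted_feature_mat M N \<phi> x w \<in> carrier_mat N M"
  unfolding weighted_feature_mat_def
  by (rule mult_carrier_mat[of _ N N]) (simp_all add: mat_diag_def)

lemma quad_norm_lin_comb: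
  assumes w: "\<And>q. q < N \<Longrightarrow> 0 \<le> w q" and a: "a \<in> carrier_vec M"
  shows "quad_norm N x w (lin_comb M \<phi> a) = norm2 (weighted_feature_mat M N \<phi> x w *\<^sub>v a)"
proof -
  have "vec_index (weighted_feature_mat M N \<phi> x w *\<^sub>v a) q = sqrt (w q) * lin_comb M \<phi> a (x q)"
    if "q < N" for q
    using that a
    by (auto simp: weighted_feature_mat_def mat_diag_mult_left[of _ N M] scalar_prod_def
        lin_comb_def sum_distrib_left mult.assoc lessThan_atLeast0)
  moreover have "dim_vec (weighted_feature_mat M N \<phi> x w *\<^sub>v a) = N"
    using weighted_feature_mat_carrier[of M N \<phi> x w] by simp
  ultimately show ?thesis
    using w by (simp add: quad_norm_def norm2_def power_mult_distrib del: index_mult_mat_vec)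
qed

lemma quad_norm_nonneg:
  assumes "\<And>q. q < N \<Longrightarrow> 0 \<le> w q"
  shows "0 \<le> quad_norm N x w v"
  using assms by (auto simp: quad_norm_def intro!: sum_nonneg)

lemma quad_norm_eq_0_imp:
  assumes w: "\<And>q. q < N \<Longrightarrow> 0 < w q" and "quad_norm N x w v = 0" "q < N"
  shows "v (x q) = 0"
proof -
  have "(\<Sum>q<N. w q * (v (x q))\<^sup>2) = 0" using assms(2) by (simp add: quad_norm_def)
  then have "\<forall>q\<in>{..<N}. w q * (v (x q))\<^sup>2 = 0"
    using w by (subst (asm) sum_nonneg_eq_0_iff) (auto simp: less_imp_le)
  then have "w q * (v (x q))\<^sup>2 = 0" using assms(3) by blast
  then show ?thesis using w[OF assms(3)] by simp
qed

text \<open>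
  The sampled norm is a weighted Euclidean norm, so the natural choice is the discrete orthogonal
  projection, with coefficients \<open>c = Q\<^sub>K\<^sup>T A a\<close>. The weighted samples of the error are then
  \<open>A a - Q\<^sub>K c = (I - Q\<^sub>K Q\<^sub>K\<^sup>T) A a\<close>. An explicit element is needed rather than a bound on an
  infimum, because the same error function is measured afterwards in the norm of \<open>X\<close>; its
  membership in the feature span makes the stability constant applicable to it.
\<close>

lemma care_approximant_exists:
  assumes w: "\<And>q. q < N \<Longrightarrow> 0 \<le> w q"
    and A: "A = weighted_feature_mat M N \<phi> x w"
    and qr: "column_pivoted_qr A P Q R" and tol: "\<tau> > 0" and K: "K \<in> qr_admissible \<tau> R"
    and a: "a \<in> carrier_vec M"
  obtains v where "v \<in> care_space M \<phi> P R K"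
    and "(\<lambda>y. lin_comb M \<phi> a y - v y) \<in> fun_span M \<phi>"
    and "quad_norm N x w (\<lambda>y. lin_comb M \<phi> a y - v y) \<le> qr_error A Q K * norm2 a"
proof -
  define B where "B = first_cols K P * the (mat_inverse (leading_block K R))"
  define QK where "QK = first_cols K Q"
  define c where "c = transpose_mat QK *\<^sub>v (A *\<^sub>v a)"
  have Ac: "A \<in> carrier_mat N M" using weighted_feature_mat_carrier A by blast
  then have Bc: "B \<in> carrier_mat M K" and AB: "A * B = QK"
    using truncated_qr_inverse[OF qr K tol] by (auto simp: B_def QK_def)
  have QKc: "QK \<in> carrier_mat N K" using mult_carrier_mat[OF Ac Bc] AB by simp
  have Aa: "A *\<^sub>v a \<in> carrier_vec N" using Ac a by simp
  have c: "c \<in> carrier_vec K" using QKc Aa by (simp add: c_def mult_mat_vec_carrier[of _ K N])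
  have Bcc: "B *\<^sub>v c \<in> carrier_vec M" using Bc c by simp
  define v where "v = lin_comb M \<phi> (B *\<^sub>v c)"
  have mem: "v \<in> care_space M \<phi> P R K"
    using c unfolding care_space_eq[OF Bc[unfolded B_def]] v_def B_def by blast
  have diff: "(\<lambda>y. lin_comb M \<phi> a y - v y) = lin_comb M \<phi> (a - B *\<^sub>v c)"
    unfolding v_def by (rule lin_comb_diff[OF a Bcc])
  let ?E = "1\<^sub>m N - QK * transpose_mat QK"
  have QQ: "QK * transpose_mat QK \<in> carrier_mat N N" using QKc by simp
  have E: "?E \<in> carrier_mat N N" using QQ by (rule minus_carrier_mat)
  have "A *\<^sub>v (a - B *\<^sub>v c) = A *\<^sub>v a - A *\<^sub>v (B *\<^sub>v c)"
    by (rule mult_minus_distrib_mat_vec[OF Ac a Bcc])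
  also have "A *\<^sub>v (B *\<^sub>v c) = QK *\<^sub>v c"
    using assoc_mult_mat_vec[OF Ac Bc c] AB by simp
  also have "QK *\<^sub>v c = (QK * transpose_mat QK) *\<^sub>v (A *\<^sub>v a)"
    unfolding c_def by (rule assoc_mult_mat_vec[symmetric, of _ N K _ N]) (use QKc Aa in auto)
  also have "A *\<^sub>v a - \<dots> = ?E *\<^sub>v (A *\<^sub>v a)"
    using minus_mult_distrib_mat_vec[OF one_carrier_mat QQ Aa] Aa by simp
  also have "\<dots> = (?E * A) *\<^sub>v a"
    using assoc_mult_mat_vec[OF E Ac a] by simp
  finally have res: "A *\<^sub>v (a - B *\<^sub>v c) = (?E * A) *\<^sub>v a" .
  have "quad_norm N x w (\<lambda>y. lin_comb M \<phi> a y - v y) = norm2 (A *\<^sub>v (a - B *\<^sub>v c))"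
    unfolding diff A by (rule quad_norm_lin_comb) (use w a Bcc in auto)
  also have "\<dots> \<le> spectral_norm (?E * A) * norm2 a"
    unfolding res by (rule norm2_mult_mat_vec_le) (use Ac a in auto)
  also have "spectral_norm (?E * A) = qr_error A Q K"
    using Ac by (simp add: qr_error_def QK_def)
  finally have bound: "quad_norm N x w (\<lambda>y. lin_comb M \<phi> a y - v y) \<le> qr_error A Q K * norm2 a" .
  have "(\<lambda>y. lin_comb M \<phi> a y - v y) \<in> fun_span M \<phi>"
    unfolding diff fun_span_def using a Bcc by auto
  with mem bound show thesis using that by blast
qed


section \<open>From the sampled norm to the norm of the function space\<close>

text \<open>
  Injectivity of sampling on \<open>V\<close> is what rules out a vanishing denominator in the stability
  constant, so its defining quotient may be multiplied out.
\<close>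

lemma norm_le_stability_const_quad_norm:
  assumes w: "\<And>q. q < N \<Longrightarrow> 0 < w q"
    and zero: "(\<lambda>y. 0) \<in> V" "nX (\<lambda>y. 0) = 0" and h: "h \<in> V" "0 \<le> nX h"
    and fin: "stability_const nX N x w V \<noteq> \<infinity>"
  shows "ennreal (nX h) \<le> stability_const nX N x w V * ennreal (quad_norm N x w h)"
proof (cases "h = (\<lambda>y. 0)")
  case True
  then show ?thesis using zero by simp
next
  case False
  have inj: "inj_on (\<lambda>v. vec N (\<lambda>q. v (x q))) V"
    using fin by (auto simp: stability_const_def split: if_splits)
  have "quad_norm N x w h \<noteq> 0"
  proof
    assume "quad_norm N x w h = 0"
    then have "\<And>q. q < N \<Longrightarrow> h (x q) = 0" using quad_norm_eq_0_imp w by blast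
    then have "vec N (\<lambda>q. h (x q)) = vec N (\<lambda>q. (\<lambda>y. 0) (x q))" by auto
    then have "h = (\<lambda>y. 0)" by (rule inj_onD[OF inj _ h(1) zero(1)])
    with False show False by simp
  qed
  moreover have "0 \<le> quad_norm N x w h" by (rule quad_norm_nonneg) (use w in \<open>simp add: less_imp_le\<close>)
  ultimately have pos: "0 < quad_norm N x w h" by simp
  have "ennreal (nX h) = ennreal (nX h / quad_norm N x w h) * ennreal (quad_norm N x w h)"
    using pos h(2) by (subst ennreal_mult[symmetric]) auto
  also have "ennreal (nX h / quad_norm N x w h) \<le> stability_const nX N x w V"
    using inj h(1) False by (auto simp: stability_const_def intro!: SUP_upper)
  finally show ?thesis by (simp add: mult_right_mono)
qed

lemma normed_function_space_diff:
  assumes nfs: "normed_function_space \<Omega> X nX" and u: "u \<in> X" and v: "v \<in> X"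
  shows "(\<lambda>y. u y - v y) \<in> X"
proof -
  have add: "\<forall>u\<in>X. \<forall>v\<in>X. (\<lambda>x. u x + v x) \<in> X"
    and scale: "\<forall>r. \<forall>u\<in>X. (\<lambda>x. r * u x) \<in> X"
    using nfs unfolding normed_function_space_def by - (elim conjE, assumption)+
  show ?thesis
    using add[rule_format, OF u scale[rule_format, OF v, of "-1"]] by simp
qed

lemma normed_function_space_norm_zero:
  assumes nfs: "normed_function_space \<Omega> X nX"
  shows "nX (\<lambda>y. 0) = 0"
proof -
  have zero: "(\<lambda>x. 0) \<in> X" and scale: "\<forall>r. \<forall>u\<in>X. nX (\<lambda>x. r * u x) = \<bar>r\<bar> * nX u"
    using nfs unfolding normed_function_space_def by - (elim conjE, assumption)+
  show ?thesis using scale[rule_format, OF zero, of 0] by simp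
qed

lemma zero_in_fun_span: "(\<lambda>y. 0) \<in> fun_span n g"
  unfolding fun_span_def by (rule image_eqI[of _ _ "0\<^sub>v n"]) (auto simp: lin_comb_def)


section \<open>Approximation by the CARE space\<close>

theorem lemma1:
  fixes \<Omega> :: "'d::euclidean_space set"
    and M N K :: nat
    and \<phi> :: "nat \<Rightarrow> 'd \<Rightarrow> real"
    and x :: "nat \<Rightarrow> 'd"
    and w :: "nat \<Rightarrow> real"
    and A P Q R :: "real mat"
    and \<tau> :: real
  assumes features: "gaussian_features \<Omega> M \<phi> \<or> periodic_gaussian_features \<Omega> M \<phi>"
    and nodes: "\<And>q. q < N \<Longrightarrow> x q \<in> \<Omega>"
    and weights: "\<And>q. q < N \<Longrightarrow> w q > 0"
    and A: "A = weighted_feature_mat M N \<phi> x w"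
    and qr: "column_pivoted_qr A P Q R"
    and tol: "\<tau> > 0"
    and admissible: "qr_admissible \<tau> R \<noteq> {}"
    and K: "K = Max (qr_admissible \<tau> R)"
  shows "(\<forall>a\<in>carrier_vec M.
           (INF v\<in>care_space M \<phi> P R K. quad_norm N x w (\<lambda>y. lin_comb M \<phi> a y - v y))
             \<le> qr_error A Q K * norm2 a) \<and>
         (\<forall>X nX. normed_function_space \<Omega> X nX \<and> contained_in_normed (fun_span M \<phi>) X nX \<longrightarrow>
           (\<forall>f\<in>X. ennreal (INF v\<in>care_space M \<phi> P R K. nX (\<lambda>y. f y - v y))
             \<le> care_bound nX (stability_const nX N x w (fun_span M \<phi>)) (qr_error A Q K) M \<phi> f))"
proof (intro conjI ballI allI impI)
  have w: "\<And>q. q < N \<Longrightarrow> 0 \<le> w q" using weights by (simp add: less_imp_le)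
  have Kadm: "K \<in> qr_admissible \<tau> R"
    unfolding K by (rule Max_in[OF _ admissible]) (simp add: qr_admissible_def)
  note approximant = care_approximant_exists[of N w A M \<phi> x, OF w A qr tol Kadm]
  {
    fix a :: "real vec" assume a: "a \<in> carrier_vec M"
    obtain v where v: "v \<in> care_space M \<phi> P R K"
      and le: "quad_norm N x w (\<lambda>y. lin_comb M \<phi> a y - v y) \<le> qr_error A Q K * norm2 a"
      using approximant[OF _ a] by blast
    have "(INF v\<in>care_space M \<phi> P R K. quad_norm N x w (\<lambda>y. lin_comb M \<phi> a y - v y))
        \<le> quad_norm N x w (\<lambda>y. lin_comb M \<phi> a y - v y)"
      by (rule cINF_lower[OF bdd_belowI2 v]) (rule quad_norm_nonneg[OF w])
    then show "(INF v\<in>care_space M \<phi> P R K. quad_norm N x w (\<lambda>y. lin_comb M \<phi> a y - v y))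
        \<le> qr_error A Q K * norm2 a"
      using le by (rule order_trans)
  }
  fix X nX f
  let ?\<Lambda> = "stability_const nX N x w (fun_span M \<phi>)"
  assume "normed_function_space \<Omega> X nX \<and> contained_in_normed (fun_span M \<phi>) X nX"
  then have nfs: "normed_function_space \<Omega> X nX" and sub: "fun_span M \<phi> \<subseteq> X"
    by (auto simp: contained_in_normed_def)
  assume f: "f \<in> X"
  have nonneg: "\<And>u. u \<in> X \<Longrightarrow> 0 \<le> nX u"
    and tri: "\<And>u v. u \<in> X \<Longrightarrow> v \<in> X \<Longrightarrow> nX (\<lambda>y. u y + v y) \<le> nX u + nX v"
    using nfs unfolding normed_function_space_def by blast+
  have "dim_col A = M" using weighted_feature_mat_carrier A by blast
  then have care_sub: "v \<in> X" if "v \<in> care_space M \<phi> P R K" for v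
    using care_space_subset[OF qr Kadm tol] sub that by blast
  have bdd: "bdd_below ((\<lambda>v. nX (\<lambda>y. f y - v y)) ` care_space M \<phi> P R K)"
    by (rule bdd_belowI2[of _ 0])
      (use nonneg normed_function_space_diff[OF nfs f] care_sub in blast)
  show "ennreal (INF v\<in>care_space M \<phi> P R K. nX (\<lambda>y. f y - v y))
      \<le> care_bound nX ?\<Lambda> (qr_error A Q K) M \<phi> f"
  proof (cases "?\<Lambda> = \<infinity>")
    case True
    then show ?thesis by (simp add: care_bound_def)
  next
    case False
    have "ennreal (INF v\<in>care_space M \<phi> P R K. nX (\<lambda>y. f y - v y))
        \<le> ennreal (nX (\<lambda>y. f y - lin_comb M \<phi> a y)) + ?\<Lambda> * ennreal (qr_error A Q K * norm2 a)"
      if a: "a \<in> carrier_vec M" for a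
    proof -
      obtain v where v: "v \<in> care_space M \<phi> P R K"
        and h: "(\<lambda>y. lin_comb M \<phi> a y - v y) \<in> fun_span M \<phi>"
        and le: "quad_norm N x w (\<lambda>y. lin_comb M \<phi> a y - v y) \<le> qr_error A Q K * norm2 a"
        using approximant[OF _ a] by blast
      let ?g = "\<lambda>y. f y - lin_comb M \<phi> a y" and ?h = "\<lambda>y. lin_comb M \<phi> a y - v y"
      have "lin_comb M \<phi> a \<in> X" using a sub by (auto simp: fun_span_def)
      then have g: "?g \<in> X" by (rule normed_function_space_diff[OF nfs f])
      have hX: "?h \<in> X" using h sub by blast
      have "(INF v\<in>care_space M \<phi> P R K. nX (\<lambda>y. f y - v y)) \<le> nX (\<lambda>y. f y - v y)"
        by (rule cINF_lower[OF bdd v])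
      also have "\<dots> \<le> nX ?g + nX ?h" using tri[OF g hX] by simp
      finally have "ennreal (INF v\<in>care_space M \<phi> P R K. nX (\<lambda>y. f y - v y))
          \<le> ennreal (nX ?g) + ennreal (nX ?h)"
        using nonneg[OF g] nonneg[OF hX] by (simp add: ennreal_plus[symmetric] ennreal_leI del: ennreal_plus)
      also have "ennreal (nX ?h) \<le> ?\<Lambda> * ennreal (quad_norm N x w ?h)"
        by (rule norm_le_stability_const_quad_norm[OF weights zero_in_fun_span
              normed_function_space_norm_zero[OF nfs] h nonneg[OF hX] False])
      also have "\<dots> \<le> ?\<Lambda> * ennreal (qr_error A Q K * norm2 a)"
        by (intro mult_left_mono ennreal_leI le) simp
      finally show ?thesis by (simp add: add_left_mono)
    qed
    then show ?thesis using False by (auto simp: care_bound_def intro!: INF_greatest)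
  qed
qed

end
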